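(* For all integers $0<m<n$, $d_{\mathrm{GH}}(\mathbb{S}^m,\mathbb{S}^n)\geq \frac{\pi}{4}$.
   Context: For an integer $m\ge 0$, $\mathbb{S}^m=\{x\in\mathbb{R}^{m+1}:\|x\|=1\}$ is the unit sphere with the geodesic distance $d_{\mathbb{S}^m}(x,x')=\arccos\langle x,x'\rangle$. The Gromov-Hausdorff distance between bounded metric spaces $X,Y$ is $d_{\mathrm{GH}}(X,Y)=\inf d_{\mathrm{H}}(f(X),g(Y))$, the infimum being over all metric spaces $Z$ and all isometric (distance-preserving) embeddings $f:X\to Z$, $g:Y\to Z$, with $d_{\mathrm{H}}$ the Hausdorff distance in $Z$. Equivalently $d_{\mathrm{GH}}(X,Y)=\frac12\inf_R \operatorname{dis}(R)$, where $R\subseteq X\times Y$ ranges over correspondences (relations whose projections to $X$ and to $Y$ are both surjective) and $\operatorname{dis}(R)=\sup_{(x,y),(x',y')\in R}|d_X(x,x')-d_Y(y,y')|$. *)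

theory Defs
  imports "HOL-Analysis.Analysis"
begin

section \<open>The Gromov-Hausdorff distance\<close>

definition isometric_embedding :: "'a metric \<Rightarrow> 'c metric \<Rightarrow> ('a \<Rightarrow> 'c) \<Rightarrow> bool" where
  "isometric_embedding X Z f \<longleftrightarrow>
     f \<in> mspace X \<rightarrow> mspace Z \<and>
     (\<forall>x\<in>mspace X. \<forall>x'\<in>mspace X. mdist Z (f x) (f x') = mdist X x x')"

definition hausdorff_dist :: "'c metric \<Rightarrow> 'c set \<Rightarrow> 'c set \<Rightarrow> real" where
  "hausdorff_dist Z A B =
     Inf {r. r > 0 \<and> (\<forall>a\<in>A. \<exists>b\<in>B. mdist Z a b < r) \<and> (\<forall>b\<in>B. \<exists>a\<in>A. mdist Z a b < r)}"

text \<open>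
  HOL cannot quantify over metric spaces of all types inside a definition. Taking the points of
  the ambient space \<open>Z\<close> from the type \<open>'a + 'b\<close> loses nothing: only the union of the two images
  matters for the Hausdorff distance, and it injects into \<open>'a + 'b\<close>
  (lemma \<open>gh_dist_le_hausdorff_dist\<close>). The carrier of \<open>Z\<close>, its metric and the two embeddings
  are otherwise arbitrary; in particular the images may overlap. The infimum is over a nonempty
  set when both spaces are bounded and nonempty (lemma \<open>gh_dist_set_nonempty\<close>).
\<close>

definition gh_dist :: "'a metric \<Rightarrow> 'b metric \<Rightarrow> real" where
  "gh_dist X Y =
     Inf {hausdorff_dist Z (f ` mspace X) (g ` mspace Y) | (Z :: ('a + 'b) metric) f g.
            isometric_embedding X Z f \<and> isometric_embedding Y Z g}"

lemma hausdorff_dist_bdd_below: "min 0 (Inf {}) \<le> hausdorff_dist Z A B"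
proof -
  have "0 \<le> Inf S" if "S \<noteq> {}" "S \<subseteq> {0<..}" for S :: "real set"
    using that by (intro cInf_greatest) (auto intro: less_imp_le)
  moreover have "{r. r > 0 \<and> (\<forall>a\<in>A. \<exists>b\<in>B. mdist Z a b < r) \<and> (\<forall>b\<in>B. \<exists>a\<in>A. mdist Z a b < r)}
      \<subseteq> {0<..}" by auto
  ultimately show ?thesis
    unfolding hausdorff_dist_def by (metis (no_types, lifting) min.coboundedI1 min.cobounded2)
qed

lemma gh_dist_le_hausdorff_dist:
  fixes X :: "'a metric" and Y :: "'b metric" and Z :: "'c metric"
  assumes f: "isometric_embedding X Z f" and g: "isometric_embedding Y Z g"
  shows "gh_dist X Y \<le> hausdorff_dist Z (f ` mspace X) (g ` mspace Y)"
proof -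
  let ?W = "f ` mspace X \<union> g ` mspace Y"
  have W: "?W \<subseteq> mspace Z"
    using f g by (auto simp: isometric_embedding_def)
  define h :: "'c \<Rightarrow> 'a + 'b" where
    "h z = (if z \<in> f ` mspace X then Inl (inv_into (mspace X) f z)
            else Inr (inv_into (mspace Y) g z))" for z
  have inj: "inj_on h ?W"
  proof (rule inj_onI)
    fix z w assume zw: "z \<in> ?W" "w \<in> ?W" "h z = h w"
    show "z = w"
    proof (cases "z \<in> f ` mspace X")
      case True
      then have "w \<in> f ` mspace X" "inv_into (mspace X) f z = inv_into (mspace X) f w"
        using zw(3) by (simp_all add: h_def split: if_splits)
      then show ?thesis using True by (meson inv_into_injective)
    next
      case False
      then have "w \<notin> f ` mspace X" "inv_into (mspace Y) g z = inv_into (mspace Y) g w"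
        using zw(3) by (simp_all add: h_def split: if_splits)
      then show ?thesis using False zw(1,2) by (meson UnE inv_into_injective)
    qed
  qed
  define k where "k = inv_into ?W h"
  have kh: "k (h z) = z" if "z \<in> ?W" for z
    using inj that by (simp add: k_def)
  define d where "d p q = (if p \<in> h ` ?W \<and> q \<in> h ` ?W then mdist Z (k p) (k q) else 0)" for p q
  have ms: "Metric_space (h ` ?W) d"
  proof
    fix p q
    show "0 \<le> d p q" "d p q = d q p"
      by (simp_all add: d_def mdist_commute)
    show "d p q = 0 \<longleftrightarrow> p = q" if pq: "p \<in> h ` ?W" "q \<in> h ` ?W"
    proof -
      obtain z w where zw: "z \<in> ?W" "w \<in> ?W" "p = h z" "q = h w"
        using pq by blast
      then have "d p q = mdist Z z w" "z \<in> mspace Z" "w \<in> mspace Z"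
        using W pq by (auto simp: d_def kh)
      then show ?thesis
        using zw inj by (metis inj_on_eq_iff mdist_zero)
    qed
  next
    fix p q r assume pqr: "p \<in> h ` ?W" "q \<in> h ` ?W" "r \<in> h ` ?W"
    obtain u v w where uvw: "u \<in> ?W" "v \<in> ?W" "w \<in> ?W" "p = h u" "q = h v" "r = h w"
      using pqr by blast
    then show "d p r \<le> d p q + d q r"
      using W pqr mdist_triangle[of u Z v w] by (auto simp: d_def kh subset_iff)
  qed
  define Z' where "Z' = metric (h ` ?W, d)"
  have Z': "mspace Z' = h ` ?W" "mdist Z' = d"
    using ms by (simp_all add: Z'_def Metric_space.mspace_metric Metric_space.mdist_metric)
  have dh: "mdist Z' (h z) (h w) = mdist Z z w" if "z \<in> ?W" "w \<in> ?W" for z w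
    using that by (auto simp: Z' d_def kh)
  have "isometric_embedding X Z' (h \<circ> f)" "isometric_embedding Y Z' (h \<circ> g)"
    using f g by (auto simp: isometric_embedding_def dh Z'(1))
  moreover have "hausdorff_dist Z' ((h \<circ> f) ` mspace X) ((h \<circ> g) ` mspace Y)
      = hausdorff_dist Z (f ` mspace X) (g ` mspace Y)"
    by (simp add: hausdorff_dist_def dh)
  ultimately show ?thesis
    unfolding gh_dist_def
    by (intro cInf_lower bdd_belowI[where m = "min 0 (Inf {})"])
       (force, auto simp del: min_le_iff_disj intro: hausdorff_dist_bdd_below)
qed

lemma gh_dist_set_nonempty:
  fixes X :: "'a metric" and Y :: "'b metric"
  assumes X: "\<And>x x'. \<lbrakk>x \<in> mspace X; x' \<in> mspace X\<rbrakk> \<Longrightarrow> mdist X x x' \<le> B"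
      and Y: "\<And>y y'. \<lbrakk>y \<in> mspace Y; y' \<in> mspace Y\<rbrakk> \<Longrightarrow> mdist Y y y' \<le> B"
  shows "\<exists>(Z :: ('a + 'b) metric) f g. isometric_embedding X Z f \<and> isometric_embedding Y Z g"
proof -
  define C where "C = max 1 B"
  have C: "C > 0" "C \<ge> 0" "B \<le> 2 * C" by (auto simp: C_def)
  define M where "M = mspace X <+> mspace Y"
  define d :: "'a + 'b \<Rightarrow> 'a + 'b \<Rightarrow> real" where
    "d p q = (case (p, q) of (Inl x, Inl x') \<Rightarrow> mdist X x x' | (Inr y, Inr y') \<Rightarrow> mdist Y y y'
              | _ \<Rightarrow> C)" for p q
  have XB: "mdist X x x' \<le> 2 * C" if "x \<in> mspace X" "x' \<in> mspace X" for x x'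
    using X[OF that] C by simp
  have YB: "mdist Y y y' \<le> 2 * C" if "y \<in> mspace Y" "y' \<in> mspace Y" for y y'
    using Y[OF that] C by simp
  have "Metric_space M d"
  proof
    fix p q
    show "0 \<le> d p q" "d p q = d q p"
      using C by (auto simp: d_def mdist_commute split: sum.splits)
    show "d p q = 0 \<longleftrightarrow> p = q" if "p \<in> M" "q \<in> M"
      using that C by (auto simp: d_def M_def split: sum.splits)
  next
    fix p q r assume "p \<in> M" "q \<in> M" "r \<in> M"
    then show "d p r \<le> d p q + d q r"
      using C
      by (elim PlusE[of _ "mspace X" "mspace Y", folded M_def])
         (simp_all add: d_def mdist_triangle XB YB)
  qed
  then have "mspace (metric (M, d)) = M" "mdist (metric (M, d)) = d"
    by (simp_all add: Metric_space.mspace_metric Metric_space.mdist_metric)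
  then have "isometric_embedding X (metric (M, d)) Inl" "isometric_embedding Y (metric (M, d)) Inr"
    by (auto simp: isometric_embedding_def M_def d_def)
  then show ?thesis by blast
qed


section \<open>Spheres with the geodesic distance\<close>

text \<open>
  \<open>nsphere m\<close> realises the unit sphere of \<open>\<real>\<^sup>m\<^sup>+\<^sup>1\<close> by the functions \<open>x :: nat \<Rightarrow> real\<close> that vanish
  beyond index \<open>m\<close> and satisfy \<open>(\<Sum>i\<le>m. (x i)\<^sup>2) = 1\<close>. The value \<open>0\<close> off the sphere
  is immaterial; it is there because \<open>Metric_space\<close> asks for a nonnegative function everywhere.
\<close>

definition geodesic_sphere :: "nat \<Rightarrow> (nat \<Rightarrow> real) metric" where
  "geodesic_sphere m =
     metric (topspace (nsphere m),
             \<lambda>x y. if x \<in> topspace (nsphere m) \<and> y \<in> topspace (nsphere m)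
                   then arccos (\<Sum>i\<le>m. x i * y i) else 0)"

lemma topspace_nsphere_eq: "topspace (nsphere m) = {x. (\<Sum>i\<le>m. (x i)\<^sup>2) = 1 \<and> (\<forall>i>m. x i = 0)}"
  by (simp add: nsphere)

lemma nsphere_inner_bounds:
  assumes "x \<in> topspace (nsphere m)" "y \<in> topspace (nsphere m)"
  shows "\<bar>\<Sum>i\<le>m. x i * y i\<bar> \<le> 1"
  using Cauchy_Schwarz_ineq_sum[of x y "{..m}"] assms
  by (simp add: topspace_nsphere_eq abs_square_le_1)

lemma nsphere_inner_eq_1:
  assumes x: "x \<in> topspace (nsphere m)" and y: "y \<in> topspace (nsphere m)"
  shows "(\<Sum>i\<le>m. x i * y i) = 1 \<longleftrightarrow> x = y"
proof
  assume 1: "(\<Sum>i\<le>m. x i * y i) = 1"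
  have "(\<Sum>i\<le>m. (x i - y i)\<^sup>2) = (\<Sum>i\<le>m. (x i)\<^sup>2) + (\<Sum>i\<le>m. (y i)\<^sup>2) - 2 * (\<Sum>i\<le>m. x i * y i)"
    by (simp add: power2_diff sum.distrib sum_subtractf sum_distrib_left mult.assoc)
  also have "\<dots> = 0"
    using x y 1 by (simp add: topspace_nsphere_eq)
  finally have "\<forall>i\<le>m. x i = y i"
    by (simp add: sum_nonneg_eq_0_iff)
  moreover have "x i = y i" if "\<not> i \<le> m" for i
    using x y that by (simp add: topspace_nsphere_eq)
  ultimately show "x = y"
    by blast
next
  assume "x = y"
  then show "(\<Sum>i\<le>m. x i * y i) = 1"
    using x by (simp add: topspace_nsphere_eq power2_eq_square)
qed

lemma nsphere_arccos_triangle: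
  assumes x: "x \<in> topspace (nsphere m)" and y: "y \<in> topspace (nsphere m)"
      and z: "z \<in> topspace (nsphere m)"
  shows "arccos (\<Sum>i\<le>m. x i * z i) \<le> arccos (\<Sum>i\<le>m. x i * y i) + arccos (\<Sum>i\<le>m. y i * z i)"
proof -
  define a where "a = (\<Sum>i\<le>m. x i * y i)"
  define b where "b = (\<Sum>i\<le>m. y i * z i)"
  define c where "c = (\<Sum>i\<le>m. x i * z i)"
  have bd: "\<bar>a\<bar> \<le> 1" "\<bar>b\<bar> \<le> 1" "\<bar>c\<bar> \<le> 1"
    unfolding a_def b_def c_def using x y z by (simp_all add: nsphere_inner_bounds)
  have n: "(\<Sum>i\<le>m. x i * x i) = 1" "(\<Sum>i\<le>m. y i * y i) = 1" "(\<Sum>i\<le>m. z i * z i) = 1"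
    using x y z by (simp_all add: topspace_nsphere_eq power2_eq_square)
  have 1: "(\<Sum>i\<le>m. (x i - a * y i) * (z i - b * y i)) = c - a * b"
  proof -
    have "(\<Sum>i\<le>m. (x i - a * y i) * (z i - b * y i))
        = (\<Sum>i\<le>m. x i * z i) - b * (\<Sum>i\<le>m. x i * y i) - a * (\<Sum>i\<le>m. y i * z i)
          + a * b * (\<Sum>i\<le>m. y i * y i)"
      by (simp add: algebra_simps sum.distrib sum_subtractf sum_distrib_left)
    then show ?thesis by (simp add: n flip: a_def b_def c_def)
  qed
  have 2: "(\<Sum>i\<le>m. (x i - a * y i)\<^sup>2) = 1 - a\<^sup>2"
  proof -
    have "(\<Sum>i\<le>m. (x i - a * y i)\<^sup>2)
        = (\<Sum>i\<le>m. x i * x i) - 2 * a * (\<Sum>i\<le>m. x i * y i) + a * a * (\<Sum>i\<le>m. y i * y i)"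
      by (simp add: power2_eq_square algebra_simps sum.distrib sum_subtractf sum_distrib_left)
    then show ?thesis by (simp add: n power2_eq_square flip: a_def)
  qed
  have 3: "(\<Sum>i\<le>m. (z i - b * y i)\<^sup>2) = 1 - b\<^sup>2"
  proof -
    have "(\<Sum>i\<le>m. (z i - b * y i)\<^sup>2)
        = (\<Sum>i\<le>m. z i * z i) - 2 * b * (\<Sum>i\<le>m. y i * z i) + b * b * (\<Sum>i\<le>m. y i * y i)"
      by (simp add: power2_eq_square algebra_simps sum.distrib sum_subtractf sum_distrib_left)
    then show ?thesis by (simp add: n power2_eq_square flip: b_def)
  qed
  have "(c - a * b)\<^sup>2 \<le> (1 - a\<^sup>2) * (1 - b\<^sup>2)"
    using Cauchy_Schwarz_ineq_sum[of "\<lambda>i. x i - a * y i" "\<lambda>i. z i - b * y i" "{..m}"]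
    by (simp add: 1 2 3)
  then have "\<bar>c - a * b\<bar> \<le> sqrt (1 - a\<^sup>2) * sqrt (1 - b\<^sup>2)"
    using real_sqrt_le_mono by (fastforce simp: real_sqrt_mult)
  then have "cos (arccos a + arccos b) \<le> c"
    using bd by (simp add: cos_add sin_arccos_abs cos_arccos_abs)
  moreover have "0 \<le> arccos a + arccos b"
    using bd by (simp add: arccos_lbound abs_le_iff)
  moreover have "arccos c \<le> pi"
    using bd by (simp add: arccos_ubound abs_le_iff)
  ultimately have "arccos c \<le> arccos a + arccos b"
    using bd by (smt (verit) arccos_cos arccos_le_arccos cos_ge_minus_one)
  then show ?thesis by (simp add: a_def b_def c_def)
qed

lemma Metric_space_geodesic_sphere:
  "Metric_space (topspace (nsphere m))
     (\<lambda>x y. if x \<in> topspace (nsphere m) \<and> y \<in> topspace (nsphere m)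
            then arccos (\<Sum>i\<le>m. x i * y i) else 0)"
proof
  fix x y :: "nat \<Rightarrow> real"
  let ?S = "topspace (nsphere m)"
  let ?d = "\<lambda>x y. if x \<in> ?S \<and> y \<in> ?S then arccos (\<Sum>i\<le>m. x i * y i) else 0"
  show "0 \<le> ?d x y"
    using nsphere_inner_bounds[of x m y] by (auto simp: abs_le_iff intro!: arccos_lbound)
  show "?d x y = ?d y x"
    by (simp add: mult.commute)
  show "?d x y = 0 \<longleftrightarrow> x = y" if "x \<in> ?S" "y \<in> ?S"
    using that nsphere_inner_bounds[OF that] nsphere_inner_eq_1[OF that]
    by (metis (no_types, lifting) arccos_1 cos_arccos_abs cos_zero)
qed (simp add: nsphere_arccos_triangle)

lemma mspace_geodesic_sphere:
  "mspace (geodesic_sphere m) = {x. (\<Sum>i\<le>m. (x i)\<^sup>2) = 1 \<and> (\<forall>i>m. x i = 0)}"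
  unfolding geodesic_sphere_def topspace_nsphere_eq[symmetric]
  by (rule Metric_space.mspace_metric[OF Metric_space_geodesic_sphere])

lemma mdist_geodesic_sphere:
  assumes "x \<in> mspace (geodesic_sphere m)" "y \<in> mspace (geodesic_sphere m)"
  shows "mdist (geodesic_sphere m) x y = arccos (\<Sum>i\<le>m. x i * y i)"
  using assms unfolding mspace_geodesic_sphere topspace_nsphere_eq[symmetric]
  by (simp add: geodesic_sphere_def Metric_space.mdist_metric[OF Metric_space_geodesic_sphere])

end

theory Submission
  imports Defs "HOL-Homology.Invariance_of_Domain"
begin

text \<open>
  A Gromov-Hausdorff distance below \<open>\<pi> / 4\<close> would give a map \<open>\<phi>\<close>, in general discontinuous, from the
  larger sphere \<open>S\<^sup>n\<close> to the smaller sphere \<open>S\<^sup>m\<close> that changes every distance by at most some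
  \<open>\<rho> < \<pi> / 2\<close> (lemma \<open>gh_dist_less_imp_almost_isometry\<close>): send \<open>y\<close> to a point of \<open>S\<^sup>m\<close> whose image in the
  common ambient space is close to that of \<open>y\<close>. Put \<open>\<epsilon> = \<pi> / 2 - \<rho>\<close>. Points at distance less
  than \<open>\<epsilon>\<close> then have images with positive inner product, and points that are within \<open>\<epsilon>\<close> of being antipodal have
  images with negative inner product. Averaging \<open>\<phi>\<close> over a finite net, with weights that are odd
  functions of the inner product, turns \<open>\<phi>\<close> into an odd Lipschitz map \<open>G\<close> from \<open>S\<^sup>n\<close> to
  \<open>\<real>\<^sup>m\<^sup>+\<^sup>1\<close>, and the two sign conditions keep \<open>G\<close> away from \<open>0\<close>
  (lemma \<open>distortion_of_sphere_map_ge\<close>). This contradicts the Borsuk-Ulam theorem.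
  
  The form of the Borsuk-Ulam theorem needed here follows from Borsuk's theorem on odd maps: if
  \<open>F : S\<^sup>k \<rightarrow> \<real>\<^sup>k\<^sup>+\<^sup>1\<close> is odd, Lipschitz and nowhere zero, then \<open>F / |F|\<close> has odd degree
  (lemma \<open>odd_degree_normalize_upto\<close>). The proof is by induction on \<open>k\<close>. The homological input is
  \<open>Borsuk_odd_mapping_degree_step\<close>, which says that an odd self-map of the sphere preserving the equator has
  the same degree modulo 2 as its restriction to the equator. To reach that situation, \<open>F\<close> is
  deformed through odd nowhere zero maps until it preserves the equator. The obstacle is that the values
  of \<open>F\<close> on the equator could point in every direction. For Lipschitz \<open>F\<close> they cannot,
  because of a dimension count (lemma \<open>exists_unattained_ratio\<close>); this is why the Lipschitz condition
  is carried along. Finally, a nowhere zero map from \<open>S\<^sup>n\<close> to \<open>\<real>\<^sup>m\<^sup>+\<^sup>1\<close> with \<open>m < n\<close>, regarded as a map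
  to \<open>\<real>\<^sup>n\<^sup>+\<^sup>1\<close>, has a normalization that is not surjective, so its degree is \<open>0\<close>, which is even.
\<close>

section \<open>The sphere as a compact set of coordinate functions\<close>

lemma nsphere_uminus: "x \<in> topspace (nsphere k) \<Longrightarrow> (\<lambda>i. - x i) \<in> topspace (nsphere k)"
  by (simp add: topspace_nsphere_eq)

lemma nsphere_mono: "k \<le> n \<Longrightarrow> topspace (nsphere k) \<subseteq> topspace (nsphere n)"
proof
  fix x assume "k \<le> n" and x: "x \<in> topspace (nsphere k)"
  then have "(\<Sum>i\<le>n. (x i)\<^sup>2) = (\<Sum>i\<le>k. (x i)\<^sup>2)"
    by (intro sum.mono_neutral_right) (auto simp: topspace_nsphere_eq)
  then show "x \<in> topspace (nsphere n)"
    using x \<open>k \<le> n\<close> by (simp add: topspace_nsphere_eq)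
qed

lemma nsphere_coordinate_le_1:
  assumes "x \<in> topspace (nsphere k)"
  shows "\<bar>x i\<bar> \<le> 1"
proof (cases "i \<le> k")
  case True
  then have "(x i)\<^sup>2 \<le> (\<Sum>i\<le>k. (x i)\<^sup>2)"
    by (intro member_le_sum) auto
  then show ?thesis
    using assms by (simp add: topspace_nsphere_eq abs_square_le_1)
qed (use assms in \<open>simp add: topspace_nsphere_eq\<close>)

lemma nsphere_eq_top_of_set: "nsphere k = top_of_set (topspace (nsphere k))"
  by (simp add: nsphere euclidean_product_topology)

lemma continuous_on_coordinate: "continuous_on S (\<lambda>x. x i :: real)"
  by (rule continuous_on_subset[OF continuous_on_product_coordinates]) simp

lemma compact_nsphere: "compact (topspace (nsphere k))"
proof -
  have "compactin (product_topology (\<lambda>i::nat. euclideanreal) UNIV) (PiE UNIV (\<lambda>i. {-1..1}))"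
    by (simp add: compactin_PiE)
  then have "compact (PiE UNIV (\<lambda>i::nat. {-1..1::real}))"
    by (simp add: euclidean_product_topology)
  moreover have "closed (topspace (nsphere k))"
    unfolding topspace_nsphere_eq
  proof (intro closed_Collect_conj closed_Collect_all)
    show "closed {x :: nat \<Rightarrow> real. (\<Sum>i\<le>k. (x i)\<^sup>2) = 1}"
      by (intro closed_Collect_eq continuous_on_sum continuous_on_power continuous_on_const
            continuous_on_coordinate)
    show "closed {x :: nat \<Rightarrow> real. k < i \<longrightarrow> x i = 0}" for i
      using closed_Collect_eq[OF continuous_on_coordinate continuous_on_const, of i 0]
      by (cases "k < i") auto
  qed
  ultimately have "compact (PiE UNIV (\<lambda>i. {-1..1}) \<inter> topspace (nsphere k))"
    by (rule compact_Int_closed)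
  moreover have "topspace (nsphere k) \<subseteq> PiE UNIV (\<lambda>i. {-1..1})"
    using nsphere_coordinate_le_1 by (auto simp: abs_le_iff minus_le_iff)
  ultimately show ?thesis
    by (simp only: Int_absorb1)
qed

text \<open>
  Lipschitz conditions are stated with the \<open>\<ell>\<^sup>1\<close> distance of the coordinates that matter. The type
  \<open>nat \<Rightarrow> real\<close> carries the product topology, so only finitely many coordinates can be
  controlled at once; on the sphere these suffice.
\<close>

lemma continuous_on_nsphere_lipschitz:
  assumes "\<And>x y. \<lbrakk>x \<in> topspace (nsphere k); y \<in> topspace (nsphere k)\<rbrakk>
             \<Longrightarrow> \<bar>g x - g y\<bar> \<le> L * (\<Sum>j\<le>k. \<bar>x j - y j\<bar>)"
  shows "continuous_on (topspace (nsphere k)) (g :: (nat \<Rightarrow> real) \<Rightarrow> real)"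
  unfolding continuous_on_def
proof
  fix x assume x: "x \<in> topspace (nsphere k)"
  have coord: "((\<lambda>y. y j) \<longlongrightarrow> x j) (at x within topspace (nsphere k))" for j
    using continuous_on_coordinate[of "topspace (nsphere k)" j] x by (simp add: continuous_on_def)
  have "((\<lambda>y. L * (\<Sum>j\<le>k. \<bar>y j - x j\<bar>)) \<longlongrightarrow> L * (\<Sum>j\<le>k. \<bar>x j - x j\<bar>))
          (at x within topspace (nsphere k))"
    by (intro tendsto_mult tendsto_sum tendsto_rabs tendsto_diff tendsto_const coord)
  then have lim: "((\<lambda>y. L * (\<Sum>j\<le>k. \<bar>y j - x j\<bar>)) \<longlongrightarrow> 0) (at x within topspace (nsphere k))"
    by simp
  have "((\<lambda>y. g y - g x) \<longlongrightarrow> 0) (at x within topspace (nsphere k))"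
    by (rule Lim_null_comparison[OF _ lim]) (auto simp: eventually_at_filter assms x)
  then show "(g \<longlongrightarrow> g x) (at x within topspace (nsphere k))"
    by (simp add: LIM_zero_iff)
qed

section \<open>Radial projection to the sphere\<close>

text \<open>
  A vector of \<open>\<real>\<^sup>k\<^sup>+\<^sup>1\<close> is represented by any function whose first \<open>k + 1\<close> values are its
  coordinates. Cutting off the later ones here means that maps to \<open>\<real>\<^sup>k\<^sup>+\<^sup>1\<close> need not be normalized beyond
  index \<open>k\<close>, and that the restriction of a map can be reused with a smaller \<open>k\<close>.
\<close>

definition normalize_upto :: "nat \<Rightarrow> (nat \<Rightarrow> real) \<Rightarrow> nat \<Rightarrow> real" where
  "normalize_upto k v = (\<lambda>i. if i \<le> k then v i / sqrt (\<Sum>j\<le>k. (v j)\<^sup>2) else 0)"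

lemma normalize_upto_cong: "(\<And>i. i \<le> k \<Longrightarrow> v i = w i) \<Longrightarrow> normalize_upto k v = normalize_upto k w"
  by (auto simp: normalize_upto_def intro!: ext)

lemma normalize_upto_uminus: "normalize_upto k (\<lambda>i. - v i) = (\<lambda>i. - normalize_upto k v i)"
  by (auto simp: normalize_upto_def)

lemma normalize_upto_in_nsphere:
  assumes "i \<le> k" "v i \<noteq> 0"
  shows "normalize_upto k v \<in> topspace (nsphere k)"
proof -
  have "(\<Sum>j\<le>k. (v j)\<^sup>2) > 0"
    using assms by (intro sum_pos2[of _ i]) auto
  then show ?thesis
    by (simp add: topspace_nsphere_eq normalize_upto_def power_divide flip: sum_divide_distrib)
qed

lemma continuous_map_normalize_upto:
  assumes cont: "\<And>i. i \<le> k \<Longrightarrow> continuous_map X euclideanreal (\<lambda>x. F x i)"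
      and nz: "\<And>x. x \<in> topspace X \<Longrightarrow> \<exists>i\<le>k. F x i \<noteq> 0"
  shows "continuous_map X (nsphere k) (\<lambda>x. normalize_upto k (F x))"
  unfolding nsphere continuous_map_in_subtopology
proof
  have pos: "(\<Sum>j\<le>k. (F x j)\<^sup>2) \<noteq> 0" if "x \<in> topspace X" for x
    using nz[OF that] by (auto simp: sum_nonneg_eq_0_iff)
  show "continuous_map X (product_topology (\<lambda>i. euclideanreal) UNIV) (\<lambda>x. normalize_upto k (F x))"
    unfolding continuous_map_componentwise_UNIV
  proof
    fix i show "continuous_map X euclideanreal (\<lambda>x. normalize_upto k (F x) i)"
    proof (cases "i \<le> k")
      case True
      have "continuous_map X euclideanreal (\<lambda>x. \<Sum>j\<le>k. (F x j)\<^sup>2)"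
        by (intro continuous_map_sum continuous_map_real_pow cont) auto
      then have "continuous_map X euclideanreal (\<lambda>x. F x i / sqrt (\<Sum>j\<le>k. (F x j)\<^sup>2))"
        using pos by (intro continuous_map_real_divide continuous_map_sqrt cont True) auto
      then show ?thesis
        by (simp add: normalize_upto_def True)
    qed (simp add: normalize_upto_def)
  qed
  show "(\<lambda>x. normalize_upto k (F x)) \<in> topspace X \<rightarrow> {x. (\<Sum>i\<le>k. (x i)\<^sup>2) = 1 \<and> (\<forall>i>k. x i = 0)}"
    unfolding topspace_nsphere_eq[symmetric] using nz by (auto intro: normalize_upto_in_nsphere)
qed

section \<open>Lipschitz images of a sphere miss a direction\<close>

lemma nsphere_large_coordinate:
  assumes x: "x \<in> topspace (nsphere k)"
  obtains j where "j \<le> k" "1 \<le> real (Suc k) * \<bar>x j\<bar>"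
proof -
  have "\<exists>j\<le>k. 1 \<le> real (Suc k) * (x j)\<^sup>2"
  proof (rule ccontr)
    assume "\<not> ?thesis"
    then have "(\<Sum>j\<le>k. real (Suc k) * (x j)\<^sup>2) < (\<Sum>j\<le>k. 1)"
      by (intro sum_strict_mono) (auto simp del: of_nat_Suc)
    then show False
      using x by (simp add: topspace_nsphere_eq flip: sum_distrib_left)
  qed
  then obtain j where j: "j \<le> k" "1 \<le> real (Suc k) * (x j)\<^sup>2" by blast
  have "(x j)\<^sup>2 \<le> \<bar>x j\<bar>"
    using nsphere_coordinate_le_1[OF x, of j] mult_left_le[of "\<bar>x j\<bar>" "\<bar>x j\<bar>"]
    by (simp add: power2_eq_square)
  then have "real (Suc k) * (x j)\<^sup>2 \<le> real (Suc k) * \<bar>x j\<bar>"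
    by (intro mult_left_mono) auto
  with j(2) have "1 \<le> real (Suc k) * \<bar>x j\<bar>"
    by linarith
  with j(1) show thesis
    by (rule that)
qed

text \<open>
  On the cap where the coordinate \<open>j\<close> is bounded away from \<open>0\<close>, the remaining coordinates form a chart
  with Lipschitz inverse: \<open>\<bar>x j - y j\<bar> (x j + y j)\<close> is controlled by the differences of the other
  squares. So the sphere is \<open>k\<close>-dimensional in a quantitative sense, although it lies in \<open>\<real>\<^sup>k\<^sup>+\<^sup>1\<close>.
\<close>

lemma nsphere_chart_bound:
  assumes x: "x \<in> topspace (nsphere k)" and y: "y \<in> topspace (nsphere k)"
      and j: "j \<le> k" "1 \<le> real (Suc k) * x j" "1 \<le> real (Suc k) * y j"
      and e: "\<And>i. \<lbrakk>i \<le> k; i \<noteq> j\<rbrakk> \<Longrightarrow> \<bar>x i - y i\<bar> \<le> e" and "0 \<le> e"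
  shows "(\<Sum>i\<le>k. \<bar>x i - y i\<bar>) \<le> (real k + 2)\<^sup>2 * e"
proof -
  have split: "(\<Sum>i\<le>k. g i) = g j + (\<Sum>i\<in>{..k}-{j}. g i)" for g :: "nat \<Rightarrow> real"
    using j(1) by (simp add: sum.remove)
  have others: "(\<Sum>i\<in>{..k}-{j}. \<bar>x i - y i\<bar>) \<le> real k * e"
    using sum_bounded_above[of "{..k}-{j}" "\<lambda>i. \<bar>x i - y i\<bar>" e] e j(1) by simp
  have "(x j)\<^sup>2 - (y j)\<^sup>2 = (\<Sum>i\<in>{..k}-{j}. (y i)\<^sup>2 - (x i)\<^sup>2)"
    using x y split[of "\<lambda>i. (x i)\<^sup>2"] split[of "\<lambda>i. (y i)\<^sup>2"]
    by (simp add: topspace_nsphere_eq sum_subtractf)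
  also have "\<bar>\<dots>\<bar> \<le> (\<Sum>i\<in>{..k}-{j}. 2 * \<bar>x i - y i\<bar>)"
  proof (rule order_trans[OF sum_abs sum_mono])
    fix i
    have "\<bar>(y i)\<^sup>2 - (x i)\<^sup>2\<bar> = \<bar>y i + x i\<bar> * \<bar>x i - y i\<bar>"
      by (simp add: power2_eq_square square_diff_square_factored abs_mult abs_minus_commute)
    also have "\<dots> \<le> 2 * \<bar>x i - y i\<bar>"
      using nsphere_coordinate_le_1[OF x, of i] nsphere_coordinate_le_1[OF y, of i]
      by (intro mult_right_mono) auto
    finally show "\<bar>(y i)\<^sup>2 - (x i)\<^sup>2\<bar> \<le> 2 * \<bar>x i - y i\<bar>" .
  qed
  finally have sq: "\<bar>(x j)\<^sup>2 - (y j)\<^sup>2\<bar> \<le> 2 * (real k * e)"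
    using others by (simp flip: sum_distrib_left)
  have "2 * \<bar>x j - y j\<bar> \<le> (real (Suc k) * (x j + y j)) * \<bar>x j - y j\<bar>"
    using j by (intro mult_right_mono) (auto simp: distrib_left)
  also have "\<dots> = real (Suc k) * \<bar>(x j)\<^sup>2 - (y j)\<^sup>2\<bar>"
  proof -
    have "0 < x j" "0 < y j"
      using j mult_nonneg_nonpos[of "real (Suc k)" "x j"] mult_nonneg_nonpos[of "real (Suc k)" "y j"]
      by linarith+
    then show ?thesis
      by (simp add: power2_eq_square square_diff_square_factored abs_mult)
  qed
  also have "\<dots> \<le> real (Suc k) * (2 * (real k * e))"
    using sq by (intro mult_left_mono) auto
  finally have "\<bar>x j - y j\<bar> \<le> real (Suc k) * (real k * e)"
    by simp
  then have "(\<Sum>i\<le>k. \<bar>x i - y i\<bar>) \<le> real (Suc k) * (real k * e) + real k * e"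
    using others split[of "\<lambda>i. \<bar>x i - y i\<bar>"] by simp
  also have "\<dots> = (real k * (real k + 2)) * e"
    by (simp add: algebra_simps)
  also have "\<dots> \<le> (real k + 2)\<^sup>2 * e"
    using \<open>0 \<le> e\<close> by (intro mult_right_mono) (auto simp: power2_eq_square)
  finally show ?thesis .
qed

text \<open>
  The ratios \<open>F x i / F x (Suc k)\<close> for \<open>i \<le> k\<close> define a partial map from the \<open>k\<close>-dimensional sphere to
  \<open>\<real>\<^sup>k\<^sup>+\<^sup>1\<close>, which is Lipschitz where it takes values in the unit cube, so it cannot cover that cube.
  To make this elementary, suppose every grid point \<open>a / M\<close> of the cube is the ratio at some point \<open>X a\<close>.
  There are \<open>(M + 1)\<^sup>k\<^sup>+\<^sup>1\<close> grid points, but the sphere is covered by a number of cells of size about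
  \<open>1 / M\<close> that grows like \<open>M\<^sup>k\<close>. Hence for large \<open>M\<close> two grid points share a cell, and
  the Lipschitz bound then contradicts the distance \<open>1 / M\<close> between distinct grid points.
\<close>

lemma exists_unattained_ratio:
  fixes F :: "(nat \<Rightarrow> real) \<Rightarrow> nat \<Rightarrow> real"
  assumes lip: "\<And>x y i. \<lbrakk>x \<in> topspace (nsphere k); y \<in> topspace (nsphere k); i \<le> Suc k\<rbrakk>
                  \<Longrightarrow> \<bar>F x i - F y i\<bar> \<le> L * (\<Sum>j\<le>k. \<bar>x j - y j\<bar>)"
      and odd: "\<And>x i. \<lbrakk>x \<in> topspace (nsphere k); i \<le> Suc k\<rbrakk> \<Longrightarrow> F (\<lambda>j. - x j) i = - F x i"
      and nz: "\<And>x. x \<in> topspace (nsphere k) \<Longrightarrow> \<exists>i\<le>Suc k. F x i \<noteq> 0"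
  obtains q where "\<And>i. i \<le> k \<Longrightarrow> 0 \<le> q i \<and> q i \<le> 1"
      and "\<And>x. x \<in> topspace (nsphere k) \<Longrightarrow> \<exists>i\<le>k. F x i \<noteq> q i * F x (Suc k)"
proof (rule ccontr)
  let ?S = "topspace (nsphere k)"
  assume "\<not> thesis"
  with that have attained: "\<exists>x\<in>?S. \<forall>i\<le>k. F x i = q i * F x (Suc k)"
    if "\<And>i. i \<le> k \<Longrightarrow> 0 \<le> q i \<and> q i \<le> 1" for q
    using that by blast
  have "?S \<noteq> {}"
    using in_topspace_nsphere by blast
  moreover have "continuous_on ?S (\<lambda>x. \<Sum>i\<le>Suc k. \<bar>F x i\<bar>)"
    by (intro continuous_on_sum continuous_on_rabs continuous_on_nsphere_lipschitz[where L = L] lip) auto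
  ultimately obtain x0 where x0: "x0 \<in> ?S"
    and min: "\<And>x. x \<in> ?S \<Longrightarrow> (\<Sum>i\<le>Suc k. \<bar>F x0 i\<bar>) \<le> (\<Sum>i\<le>Suc k. \<bar>F x i\<bar>)"
    using continuous_attains_inf[OF compact_nsphere] by blast
  \<comment> \<open>By compactness \<open>F\<close> is bounded away from \<open>0\<close>. Where all ratios lie in \<open>[0, 1]\<close>, the last
    coordinate of \<open>F\<close> is the largest, so it is at least \<open>c\<close> in absolute value.\<close>
  define c where "c = (\<Sum>i\<le>Suc k. \<bar>F x0 i\<bar>) / (real k + 2)"
  have "(\<Sum>i\<le>Suc k. \<bar>F x0 i\<bar>) > 0"
  proof -
    obtain i where "i \<le> Suc k" "F x0 i \<noteq> 0"
      using nz[OF x0] by blast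
    then show ?thesis
      by (intro sum_pos2[of _ i]) auto
  qed
  then have c: "c > 0"
    by (simp add: c_def)
  have last: "c \<le> \<bar>F x (Suc k)\<bar>"
    if x: "x \<in> ?S" and q: "\<And>i. i \<le> k \<Longrightarrow> 0 \<le> q i \<and> q i \<le> 1"
      and eq: "\<forall>i\<le>k. F x i = q i * F x (Suc k)" for x q
  proof -
    have "\<bar>F x i\<bar> \<le> \<bar>F x (Suc k)\<bar>" if "i \<le> Suc k" for i
    proof (cases "i = Suc k")
      case False
      then have "i \<le> k" using that by simp
      then show ?thesis
        using q[of i] eq mult_right_mono[of "q i" 1 "\<bar>F x (Suc k)\<bar>"] by (simp add: abs_mult)
    qed simp
    then have "(\<Sum>i\<le>Suc k. \<bar>F x i\<bar>) \<le> (\<Sum>i\<le>Suc k. \<bar>F x (Suc k)\<bar>)"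
      by (intro sum_mono) simp
    also have "\<dots> = (real k + 2) * \<bar>F x (Suc k)\<bar>"
      by simp
    finally have "(\<Sum>i\<le>Suc k. \<bar>F x0 i\<bar>) \<le> (real k + 2) * \<bar>F x (Suc k)\<bar>"
      using min[OF x] by linarith
    then show ?thesis
      by (simp add: c_def divide_le_eq mult.commute)
  qed
  \<comment> \<open>Two points in one cell of size \<open>1 / N\<close> have ratios at distance at most \<open>K / N\<close>; \<open>C > K\<close> and
    \<open>N = C * M\<close> make this less than the grid spacing \<open>1 / M\<close>, whatever \<open>M\<close> is. The value of \<open>M\<close> is
    the one for which the count \<open>M * (M + 1) ^ k < (M + 1) ^ Suc k\<close> of cells against grid points works.\<close>
  define K where "K = \<bar>L\<bar> * 2 * (real k + 2)\<^sup>2 / c"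
  obtain C :: nat where C: "K < real C"
    using reals_Archimedean2 by blast
  have "0 \<le> K"
    using c by (simp add: K_def)
  then have C0: "0 < C"
    using C by linarith
  define M where "M = Suc k * (2 * C + 1) ^ k"
  define N where "N = C * M"
  have M0: "0 < M" and N0: "0 < N"
    using C0 by (simp_all add: M_def N_def)
  define Q where "Q = PiE {..k} (\<lambda>_. {..M})"
  have Q01: "0 \<le> real (a i) / real M \<and> real (a i) / real M \<le> 1" if "a \<in> Q" "i \<le> k" for a i
    using that M0 by (auto simp: Q_def PiE_def Pi_def)
  have "\<exists>x j. x \<in> ?S \<and> j \<le> k \<and> 1 \<le> real (Suc k) * x j \<and>
          (\<forall>i\<le>k. F x i = real (a i) / real M * F x (Suc k))" if a: "a \<in> Q" for a
  proof -
    obtain x where x: "x \<in> ?S" "\<forall>i\<le>k. F x i = real (a i) / real M * F x (Suc k)"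
      using attained[of "\<lambda>i. real (a i) / real M"] Q01[OF a] by blast
    obtain j where j: "j \<le> k" "1 \<le> real (Suc k) * \<bar>x j\<bar>"
      using nsphere_large_coordinate[OF x(1)] .
    show ?thesis
    \<comment> \<open>Ratios are the same at antipodal points, so the large coordinate can be taken positive.\<close>
    proof (cases "0 \<le> x j")
      case True
      then show ?thesis
        using x j by (metis abs_of_nonneg)
    next
      case False
      have "\<forall>i\<le>k. F (\<lambda>l. - x l) i = real (a i) / real M * F (\<lambda>l. - x l) (Suc k)"
        using x odd[OF x(1)] by simp
      moreover have "1 \<le> real (Suc k) * (- x j)"
        using j(2) False by (metis abs_of_nonpos linear)
      ultimately show ?thesis
        using nsphere_uminus[OF x(1)] j(1) by blast
    qed
  qed
  then obtain X J where X: "\<And>a. a \<in> Q \<Longrightarrow> X a \<in> ?S" and J: "\<And>a. a \<in> Q \<Longrightarrow> J a \<le> k"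
    and XJ: "\<And>a. a \<in> Q \<Longrightarrow> 1 \<le> real (Suc k) * X a (J a)"
    and FX: "\<And>a. a \<in> Q \<Longrightarrow> \<forall>i\<le>k. F (X a) i = real (a i) / real M * F (X a) (Suc k)"
    by metis
  define cell where
    "cell a = (J a, restrict (\<lambda>i. \<lfloor>real N * X a i\<rfloor>) ({..k} - {J a}))" for a :: "nat \<Rightarrow> nat"
  define cells where "cells = (SIGMA j:{..k}. PiE ({..k} - {j}) (\<lambda>_. {-int N..int N}))"
  have "cell a \<in> cells" if a: "a \<in> Q" for a
  proof -
    have "\<lfloor>real N * X a i\<rfloor> \<in> {-int N..int N}" for i
    proof -
      have "\<bar>real N * X a i\<bar> \<le> real N"
        using nsphere_coordinate_le_1[OF X[OF a], of i] mult_left_le[of "\<bar>X a i\<bar>" "real N"]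
        by (simp add: abs_mult)
      then show ?thesis
        by (simp add: le_floor_iff floor_le_iff abs_le_iff)
    qed
    then show ?thesis
      using J[OF a] by (auto simp: cell_def cells_def)
  qed
  then have "cell ` Q \<subseteq> cells"
    by blast
  moreover have "finite cells"
    by (auto simp: cells_def intro!: finite_PiE)
  moreover have "card cells < card Q"
  proof -
    have "card cells = Suc k * (2 * N + 1) ^ k"
      by (simp add: cells_def card_SigmaI finite_PiE card_PiE nat_add_distrib nat_mult_distrib)
    also have "\<dots> \<le> Suc k * ((2 * C + 1) * (M + 1)) ^ k"
      by (intro mult_le_mono2 power_mono) (auto simp: N_def algebra_simps)
    also have "\<dots> = M * (M + 1) ^ k"
      by (simp only: power_mult_distrib mult.assoc[symmetric] flip: M_def)
    also have "\<dots> < (M + 1) ^ Suc k"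
      by simp
    also have "\<dots> = card Q"
      by (simp add: Q_def card_PiE)
    finally show ?thesis .
  qed
  ultimately have "\<not> inj_on cell Q"
    by (meson card_inj_on_le not_le)
  then obtain a b where a: "a \<in> Q" and b: "b \<in> Q" and ab: "a \<noteq> b" "cell a = cell b"
    by (auto simp: inj_on_def)
  have "\<exists>i\<le>k. a i \<noteq> b i"
    using PiE_ext[of a "{..k}" "\<lambda>_. {..M}" b] a b ab(1) by (auto simp: Q_def)
  then obtain i where i: "i \<le> k" "a i \<noteq> b i"
    by blast
  define D where "D = (\<Sum>j\<le>k. \<bar>X a j - X b j\<bar>)"
  have JJ: "J a = J b"
    using ab(2) by (simp add: cell_def)
  have "D \<le> (real k + 2)\<^sup>2 * (1 / real N)"
    unfolding D_def
  proof (rule nsphere_chart_bound[OF X[OF a] X[OF b] J[OF a] XJ[OF a]])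
    show "1 \<le> real (Suc k) * X b (J a)"
      using XJ[OF b] JJ by simp
    fix l assume l: "l \<le> k" "l \<noteq> J a"
    have "snd (cell a) l = snd (cell b) l"
      using ab(2) by simp
    then have "\<lfloor>real N * X a l\<rfloor> = \<lfloor>real N * X b l\<rfloor>"
      using l JJ by (simp add: cell_def)
    then have "\<bar>real N * X a l - real N * X b l\<bar> \<le> 1"
      by linarith
    then have "real N * \<bar>X a l - X b l\<bar> \<le> 1"
      by (simp add: abs_mult flip: right_diff_distrib)
    then show "\<bar>X a l - X b l\<bar> \<le> 1 / real N"
      using N0 by (simp add: field_simps)
  qed (use N0 in simp)
  then have "\<bar>L\<bar> * 2 * D \<le> \<bar>L\<bar> * 2 * ((real k + 2)\<^sup>2 * (1 / real N))"
    by (intro mult_left_mono) auto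
  also have "\<dots> = c * (K / real N)"
    using c by (simp add: K_def)
  also have "\<dots> < c * (1 / real M)"
    using C C0 M0 c by (intro mult_strict_left_mono) (simp_all add: N_def field_simps)
  finally have small: "\<bar>L\<bar> * 2 * D < c * (1 / real M)" .
  define \<alpha> where "\<alpha> = real (a i) / real M"
  define \<beta> where "\<beta> = real (b i) / real M"
  have gap: "1 / real M \<le> \<bar>\<alpha> - \<beta>\<bar>"
  proof -
    have "1 \<le> \<bar>real (a i) - real (b i)\<bar>"
      using i(2) by linarith
    then show ?thesis
      using M0 by (simp add: \<alpha>_def \<beta>_def divide_right_mono flip: diff_divide_distrib)
  qed
  have "c * (1 / real M) \<le> \<bar>F (X a) (Suc k)\<bar> * \<bar>\<alpha> - \<beta>\<bar>"
    using last[OF X[OF a], of "\<lambda>i. real (a i) / real M"] FX[OF a] Q01[OF a] gap c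
    by (intro mult_mono) auto
  also have "\<dots> = \<bar>(F (X a) i - F (X b) i) + \<beta> * (F (X b) (Suc k) - F (X a) (Suc k))\<bar>"
    using FX[OF a] FX[OF b] i(1) by (simp add: \<alpha>_def \<beta>_def algebra_simps flip: abs_mult)
  also have "\<dots> \<le> \<bar>F (X a) i - F (X b) i\<bar> + \<bar>\<beta>\<bar> * \<bar>F (X b) (Suc k) - F (X a) (Suc k)\<bar>"
    by (metis abs_mult abs_triangle_ineq)
  also have "\<dots> \<le> \<bar>L\<bar> * D + 1 * (\<bar>L\<bar> * D)"
  proof -
    have *: "\<bar>F (X a) j - F (X b) j\<bar> \<le> \<bar>L\<bar> * D" if "j \<le> Suc k" for j
    proof -
      have "L * D \<le> \<bar>L\<bar> * D"
        by (intro mult_right_mono) (auto simp: D_def sum_nonneg)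
      then show ?thesis
        using lip[OF X[OF a] X[OF b] that] by (simp add: D_def)
    qed
    show ?thesis
      using *[of i] *[of "Suc k"] Q01[OF b i(1)] i(1)
      by (intro add_mono mult_mono) (auto simp: \<beta>_def abs_minus_commute)
  qed
  finally show False
    using small by (simp add: mult_ac)
qed

section \<open>Odd maps have odd degree\<close>

text \<open>
  Borsuk's theorem for Lipschitz maps. In the step from \<open>k\<close> to \<open>k + 1\<close>, let \<open>q\<close> be such that on the
  equator \<open>F\<close> never points in the direction \<open>\<plusminus>(q, 1)\<close>. A shear moving \<open>(q, 1)\<close> to the pole, combined with a
  multiplication of the last coordinate of \<open>F\<close> by \<open>\<bar>x (k + 1)\<bar>\<close>, keeps the map odd and makes its last
  coordinate vanish on the equator; the shear ensures that the other coordinates do not all vanish there. The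
  restriction to the equator is again odd, Lipschitz and nowhere zero, so the induction
  hypothesis applies to it.
\<close>

lemma odd_degree_normalize_upto:
  fixes F :: "(nat \<Rightarrow> real) \<Rightarrow> nat \<Rightarrow> real"
  assumes "\<And>x y i. \<lbrakk>x \<in> topspace (nsphere k); y \<in> topspace (nsphere k); i \<le> k\<rbrakk>
              \<Longrightarrow> \<bar>F x i - F y i\<bar> \<le> L * (\<Sum>j\<le>k. \<bar>x j - y j\<bar>)"
      and "\<And>x i. \<lbrakk>x \<in> topspace (nsphere k); i \<le> k\<rbrakk> \<Longrightarrow> F (\<lambda>j. - x j) i = - F x i"
      and "\<And>x. x \<in> topspace (nsphere k) \<Longrightarrow> \<exists>i\<le>k. F x i \<noteq> 0"
  shows "odd (Brouwer_degree2 k (\<lambda>x. normalize_upto k (F x)))"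
  using assms
proof (induction k arbitrary: F L)
  case 0
  define e :: "nat \<Rightarrow> real" where "e = (\<lambda>i. if i = 0 then 1 else 0)"
  have e: "e \<in> topspace (nsphere 0)"
    by (simp add: e_def topspace_nsphere_eq)
  have cases: "x = e \<or> x = (\<lambda>i. - e i)" if "x \<in> topspace (nsphere 0)" for x
    using that by (auto simp: topspace_nsphere_eq power2_eq_1_iff e_def fun_eq_iff)
  have norm: "normalize_upto 0 v = (\<lambda>i. if i = 0 then sgn (v 0) else 0)" for v
    by (auto simp: normalize_upto_def sgn_if fun_eq_iff)
  have F0: "F e 0 \<noteq> 0"
    using "0.prems"(3)[OF e] by simp
  have Fm: "F (\<lambda>i. - e i) 0 = - F e 0"
    using "0.prems"(2)[OF e] by simp
  show ?case
  proof (cases "F e 0 > 0")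
    case True
    \<comment> \<open>\<open>S\<^sup>0\<close> has only two points, so an odd self-map is the identity or the reflection.\<close>
    have "Brouwer_degree2 0 (\<lambda>x. normalize_upto 0 (F x)) = Brouwer_degree2 0 id"
    proof (rule Brouwer_degree2_eq)
      fix x assume "x \<in> topspace (nsphere 0)"
      then consider "x = e" | "x = (\<lambda>i. - e i)" using cases by blast
      then show "normalize_upto 0 (F x) = id x"
        by cases (use True Fm in \<open>simp_all add: norm\<close>, auto simp: e_def)
    qed
    then show ?thesis by simp
  next
    case False
    have "Brouwer_degree2 0 (\<lambda>x. normalize_upto 0 (F x)) =
          Brouwer_degree2 0 (\<lambda>x i. if i = 0 then - x i else x i)"
    proof (rule Brouwer_degree2_eq)
      fix x assume "x \<in> topspace (nsphere 0)"
      then consider "x = e" | "x = (\<lambda>i. - e i)" using cases by blast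
      then show "normalize_upto 0 (F x) = (\<lambda>i. if i = 0 then - x i else x i)"
        by cases (use False F0 Fm in \<open>simp_all add: norm\<close>, auto simp: e_def)
    qed
    then show ?thesis by (simp add: Brouwer_degree2_reflection)
  qed
next
  case (Suc k)
  let ?S = "topspace (nsphere k)" and ?S' = "topspace (nsphere (Suc k))"
  have sub: "?S \<subseteq> ?S'"
    by (rule nsphere_mono) simp
  have eq0: "x (Suc k) = 0" if "x \<in> ?S" for x
    using that by (simp add: topspace_nsphere_eq)
  have lip: "\<bar>F x i - F y i\<bar> \<le> L * (\<Sum>j\<le>k. \<bar>x j - y j\<bar>)"
    if "x \<in> ?S" "y \<in> ?S" "i \<le> Suc k" for x y i
  proof -
    have "(\<Sum>j\<le>Suc k. \<bar>x j - y j\<bar>) = (\<Sum>j\<le>k. \<bar>x j - y j\<bar>)"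
      using eq0[OF that(1)] eq0[OF that(2)] by simp
    then show ?thesis
      using Suc.prems(1)[of x y i] that sub by (metis subsetD)
  qed
  obtain q where q: "\<And>i. i \<le> k \<Longrightarrow> 0 \<le> q i \<and> q i \<le> 1"
    and avoid: "\<And>x. x \<in> ?S \<Longrightarrow> \<exists>i\<le>k. F x i \<noteq> q i * F x (Suc k)"
  proof (rule exists_unattained_ratio[of k F L])
    show "\<exists>i\<le>Suc k. F x i \<noteq> 0" if "x \<in> ?S" for x
      using Suc.prems(3) sub that by blast
    show "F (\<lambda>j. - x j) i = - F x i" if "x \<in> ?S" "i \<le> Suc k" for x i
      using Suc.prems(2) sub that by blast
  qed (use lip in auto)
  \<comment> \<open>The shear fixes the last coordinate. So before the end of the deformation a zero of \<open>H t\<close> would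
    be a zero of \<open>F\<close>, and at \<open>t = 1\<close> the only other way to vanish is on the equator, which the choice of \<open>q\<close> excludes.\<close>
  define H where "H t x i = (if i \<le> k then F x i - t * q i * F x (Suc k)
                              else F x (Suc k) * (1 - t + t * \<bar>x (Suc k)\<bar>))"
    for t :: real and x :: "nat \<Rightarrow> real" and i
  have contF: "continuous_map (nsphere (Suc k)) euclideanreal (\<lambda>x. F x i)" if "i \<le> Suc k" for i
    using continuous_on_nsphere_lipschitz[of "Suc k" "\<lambda>x. F x i" L] Suc.prems(1) that
    by (metis (no_types, lifting) continuous_map_iff_continuous nsphere_eq_top_of_set)
  have H_nz: "\<exists>i\<le>Suc k. H t x i \<noteq> 0" if t: "0 \<le> t" "t \<le> 1" and x: "x \<in> ?S'" for t x
  proof (rule ccontr)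
    assume "\<not> ?thesis"
    then have z: "\<And>i. i \<le> Suc k \<Longrightarrow> H t x i = 0" by blast
    show False
    proof (cases "F x (Suc k) = 0")
      case True
      then have "F x i = 0" if "i \<le> Suc k" for i
        using z[OF that] that by (auto simp: H_def le_Suc_eq)
      then show False
        using Suc.prems(3)[OF x] by blast
    next
      case False
      then have "1 - t + t * \<bar>x (Suc k)\<bar> = 0"
        using z[of "Suc k"] by (simp add: H_def)
      moreover have "0 \<le> t * \<bar>x (Suc k)\<bar>"
        using t by simp
      ultimately have "t = 1"
        using t by linarith
      with \<open>1 - t + t * \<bar>x (Suc k)\<bar> = 0\<close> have "x (Suc k) = 0"
        by simp
      with topspace_nsphere_minus1[OF x] have "x \<in> ?S"
        by simp
      moreover have "F x i = q i * F x (Suc k)" if "i \<le> k" for i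
        using z[of i] that \<open>t = 1\<close> by (simp add: H_def)
      ultimately show False
        using avoid by blast
    qed
  qed
  let ?N = "normalize_upto (Suc k)"
  have "homotopic_with (\<lambda>x. True) (nsphere (Suc k)) (nsphere (Suc k))
          (\<lambda>x. ?N (H 0 x)) (\<lambda>x. ?N (H 1 x))"
    unfolding homotopic_with_def
  proof (intro exI[of _ "\<lambda>p. ?N (H (fst p) (snd p))"] conjI allI)
    let ?X = "prod_topology (top_of_set {0..1::real}) (nsphere (Suc k))"
    have t: "continuous_map ?X euclideanreal (\<lambda>p. fst p)"
      by (rule continuous_map_into_fulltopology[OF continuous_map_fst])
    have x: "continuous_map ?X (nsphere (Suc k)) (\<lambda>p. snd p)"
      by (rule continuous_map_snd)
    have Fx: "continuous_map ?X euclideanreal (\<lambda>p. F (snd p) i)" if "i \<le> Suc k" for i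
      using continuous_map_compose[OF x contF[OF that]] by (simp add: o_def)
    have xi: "continuous_map ?X euclideanreal (\<lambda>p. snd p (Suc k))"
      using continuous_map_compose[OF x continuous_map_nsphere_projection] by (simp add: o_def)
    show "continuous_map ?X (nsphere (Suc k)) (\<lambda>p. ?N (H (fst p) (snd p)))"
    proof (rule continuous_map_normalize_upto)
      show "continuous_map ?X euclideanreal (\<lambda>p. H (fst p) (snd p) i)" if "i \<le> Suc k" for i
      proof (cases "i \<le> k")
        case True
        then show ?thesis
          unfolding H_def
          by (simp add: continuous_map_diff continuous_map_real_mult continuous_map_real_mult_right t Fx)
      next
        case False
        then show ?thesis
          unfolding H_def
          by (simp add: continuous_map_diff continuous_map_add continuous_map_real_mult
              continuous_map_real_abs t Fx xi)
      qed
    qed (auto intro: H_nz)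
  qed auto
  then have deg01: "Brouwer_degree2 (Suc k) (\<lambda>x. ?N (H 0 x)) = Brouwer_degree2 (Suc k) (\<lambda>x. ?N (H 1 x))"
    and cont1: "continuous_map (nsphere (Suc k)) (nsphere (Suc k)) (\<lambda>x. ?N (H 1 x))"
    using Brouwer_degree2_homotopic homotopic_with_imp_continuous_maps by blast+
  have "?N (H 0 x) = ?N (F x)" for x
    by (rule normalize_upto_cong) (auto simp: H_def le_Suc_eq)
  note deg0 = deg01[unfolded this]
  have H1_odd: "H 1 (\<lambda>j. - x j) i = - H 1 x i" if "x \<in> ?S'" "i \<le> Suc k" for x i
    using Suc.prems(2)[OF that(1)] that(2) by (simp add: H_def)
  have restr: "?N (H 1 x) = normalize_upto k (H 1 x)" if "x \<in> ?S" for x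
    using eq0[OF that] by (auto simp: normalize_upto_def H_def fun_eq_iff)
  have nz1: "\<exists>i\<le>k. H 1 x i \<noteq> 0" if "x \<in> ?S" for x
    using avoid[OF that] by (auto simp: H_def)
  have "even (Brouwer_degree2 (Suc k) (\<lambda>x. ?N (H 1 x)) -
              Brouwer_degree2 (Suc k - Suc 0) (\<lambda>x. ?N (H 1 x)))"
  proof (rule Borsuk_odd_mapping_degree_step[OF cont1])
    fix u assume u: "u \<in> ?S'"
    have "?N (H 1 (\<lambda>j. - u j)) = ?N (\<lambda>i. - H 1 u i)"
      by (rule normalize_upto_cong) (rule H1_odd[OF u])
    then show "((\<lambda>x. ?N (H 1 x)) \<circ> (\<lambda>x i. - x i)) u = ((\<lambda>x i. - x i) \<circ> (\<lambda>x. ?N (H 1 x))) u"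
      by (simp add: normalize_upto_uminus)
  next
    show "(\<lambda>x. ?N (H 1 x)) \<in> topspace (nsphere (Suc k - Suc 0)) \<rightarrow> topspace (nsphere (Suc k - Suc 0))"
      using nz1 normalize_upto_in_nsphere by (fastforce simp: restr)
  qed
  moreover have "Brouwer_degree2 k (\<lambda>x. ?N (H 1 x)) = Brouwer_degree2 k (\<lambda>x. normalize_upto k (H 1 x))"
    by (rule Brouwer_degree2_eq) (rule restr)
  moreover have "odd (Brouwer_degree2 k (\<lambda>x. normalize_upto k (H 1 x)))"
  proof (rule Suc.IH)
    fix x y i assume xy: "x \<in> ?S" "y \<in> ?S" and i: "i \<le> k"
    have L0: "0 \<le> L * (\<Sum>j\<le>k. \<bar>x j - y j\<bar>)"
      using lip[OF xy, of 0] by linarith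
    have "\<bar>H 1 x i - H 1 y i\<bar> = \<bar>(F x i - F y i) - q i * (F x (Suc k) - F y (Suc k))\<bar>"
      using i by (simp add: H_def algebra_simps)
    also have "\<dots> \<le> \<bar>F x i - F y i\<bar> + \<bar>q i\<bar> * \<bar>F x (Suc k) - F y (Suc k)\<bar>"
      by (metis abs_mult abs_triangle_ineq4)
    also have "\<dots> \<le> L * (\<Sum>j\<le>k. \<bar>x j - y j\<bar>) + 1 * (L * (\<Sum>j\<le>k. \<bar>x j - y j\<bar>))"
      using q[OF i] L0 i by (intro add_mono mult_mono lip[OF xy]) auto
    finally show "\<bar>H 1 x i - H 1 y i\<bar> \<le> (2 * L) * (\<Sum>j\<le>k. \<bar>x j - y j\<bar>)"
      by simp
  qed (use H1_odd nz1 sub in auto)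
  ultimately show ?case
    using deg0 by simp
qed

section \<open>The Borsuk-Ulam theorem for Lipschitz maps\<close>

corollary no_odd_lipschitz_map_to_lower_dimension:
  fixes F :: "(nat \<Rightarrow> real) \<Rightarrow> nat \<Rightarrow> real"
  assumes "m < n"
      and lip: "\<And>x y i. \<lbrakk>x \<in> topspace (nsphere n); y \<in> topspace (nsphere n); i \<le> m\<rbrakk>
              \<Longrightarrow> \<bar>F x i - F y i\<bar> \<le> L * (\<Sum>j\<le>n. \<bar>x j - y j\<bar>)"
      and odd: "\<And>x i. \<lbrakk>x \<in> topspace (nsphere n); i \<le> m\<rbrakk> \<Longrightarrow> F (\<lambda>j. - x j) i = - F x i"
  obtains x where "x \<in> topspace (nsphere n)" "\<And>i. i \<le> m \<Longrightarrow> F x i = 0"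
proof (rule ccontr)
  assume "\<not> thesis"
  with that have nz: "\<exists>i\<le>m. F x i \<noteq> 0" if "x \<in> topspace (nsphere n)" for x
    using that by blast
  define G where "G x i = (if i \<le> m then F x i else 0)" for x i
  have Gnz: "\<exists>i\<le>n. G x i \<noteq> 0" if "x \<in> topspace (nsphere n)" for x
    using nz[OF that] \<open>m < n\<close> by (auto simp: G_def intro: less_imp_le le_less_trans)
  let ?g = "\<lambda>x. normalize_upto n (G x)"
  have Glip: "\<bar>G x i - G y i\<bar> \<le> L * (\<Sum>j\<le>n. \<bar>x j - y j\<bar>)"
    if "x \<in> topspace (nsphere n)" "y \<in> topspace (nsphere n)" for x y i
    using lip[OF that, of i] lip[OF that, of 0] by (auto simp: G_def)
  have "odd (Brouwer_degree2 n ?g)"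
    by (rule odd_degree_normalize_upto[OF Glip _ Gnz]) (auto simp: G_def odd)
  moreover have "Brouwer_degree2 n ?g = 0"
  proof (rule Brouwer_degree2_nonsurjective)
    show "continuous_map (nsphere n) (nsphere n) ?g"
    proof (rule continuous_map_normalize_upto[OF _ Gnz])
      fix i
      have "continuous_on (topspace (nsphere n)) (\<lambda>x. G x i)"
        by (rule continuous_on_nsphere_lipschitz[OF Glip])
      then show "continuous_map (nsphere n) euclideanreal (\<lambda>x. G x i)"
        by (metis continuous_map_iff_continuous nsphere_eq_top_of_set)
    qed
    define p :: "nat \<Rightarrow> real" where "p = (\<lambda>i. if i = n then 1 else 0)"
    have "p \<in> topspace (nsphere n)"
      by (simp add: p_def topspace_nsphere_eq if_distrib[of "\<lambda>x. x\<^sup>2"] cong: if_cong)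
    moreover have "?g x n \<noteq> p n" for x
      using \<open>m < n\<close> by (simp add: normalize_upto_def G_def p_def)
    ultimately show "?g ` topspace (nsphere n) \<noteq> topspace (nsphere n)"
      by (metis (no_types, lifting) imageE)
  qed
  ultimately show False by simp
qed

section \<open>Maps of small distortion\<close>

text \<open>
  Each \<open>y\<close> is sent to some \<open>x\<close> whose image in the ambient space has distance less than \<open>s\<close> from that of \<open>y\<close>;
  moving both endpoints changes a distance by at most \<open>2 * s\<close>. The bound \<open>B\<close> on the diameters and the nonemptiness of the spaces
  make the sets whose infima define the two distances nonempty; the infimum of an empty set of reals
  would be a meaningless default value.
\<close>

lemma gh_dist_less_imp_almost_isometry:
  fixes X :: "'a metric" and Y :: "'b metric"
  assumes less: "gh_dist X Y < r"
      and X: "\<And>x x'. \<lbrakk>x \<in> mspace X; x' \<in> mspace X\<rbrakk> \<Longrightarrow> mdist X x x' \<le> B"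
      and Y: "\<And>y y'. \<lbrakk>y \<in> mspace Y; y' \<in> mspace Y\<rbrakk> \<Longrightarrow> mdist Y y y' \<le> B"
      and ne: "mspace X \<noteq> {}" "mspace Y \<noteq> {}"
  obtains s \<phi> where "0 < s" "s < r" "\<phi> \<in> mspace Y \<rightarrow> mspace X"
      "\<And>y y'. \<lbrakk>y \<in> mspace Y; y' \<in> mspace Y\<rbrakk> \<Longrightarrow> \<bar>mdist X (\<phi> y) (\<phi> y') - mdist Y y y'\<bar> \<le> 2 * s"
proof -
  let ?D = "{hausdorff_dist Z (f ` mspace X) (g ` mspace Y) | (Z :: ('a + 'b) metric) f g.
               isometric_embedding X Z f \<and> isometric_embedding Y Z g}"
  have "?D \<noteq> {}"
    proof -
    obtain Z :: "('a + 'b) metric" and f g where "isometric_embedding X Z f" "isometric_embedding Y Z g"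
      using gh_dist_set_nonempty[of X B Y] X Y by blast
    then have "hausdorff_dist Z (f ` mspace X) (g ` mspace Y) \<in> ?D"
      by blast
    then show ?thesis
      by (rule ex_in_conv[THEN iffD1, OF exI])
  qed
  from cInf_lessD[OF this less[unfolded gh_dist_def]] obtain h where "h \<in> ?D" "h < r"
    by (elim bexE)
  then obtain Z :: "('a + 'b) metric" and f g where
    fg: "isometric_embedding X Z f" "isometric_embedding Y Z g"
    and lt: "hausdorff_dist Z (f ` mspace X) (g ` mspace Y) < r"
    by blast
  let ?R = "{r. r > 0 \<and> (\<forall>a\<in>f ` mspace X. \<exists>b\<in>g ` mspace Y. mdist Z a b < r) \<and>
              (\<forall>b\<in>g ` mspace Y. \<exists>a\<in>f ` mspace X. mdist Z a b < r)}"
  have f: "\<And>x. x \<in> mspace X \<Longrightarrow> f x \<in> mspace Z"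
      "\<And>x x'. \<lbrakk>x \<in> mspace X; x' \<in> mspace X\<rbrakk> \<Longrightarrow> mdist Z (f x) (f x') = mdist X x x'"
    and g: "\<And>y. y \<in> mspace Y \<Longrightarrow> g y \<in> mspace Z"
      "\<And>y y'. \<lbrakk>y \<in> mspace Y; y' \<in> mspace Y\<rbrakk> \<Longrightarrow> mdist Z (g y) (g y') = mdist Y y y'"
    using fg by (auto simp: isometric_embedding_def)
  obtain x0 y0 where x0: "x0 \<in> mspace X" and y0: "y0 \<in> mspace Y"
    using ne by blast
  define b where "b = B + mdist Z (f x0) (g y0) + B + 1"
  have bound: "mdist Z (f x) (g y) < b" if x: "x \<in> mspace X" and y: "y \<in> mspace Y" for x y
    using mdist_triangle[OF f(1)[OF x] f(1)[OF x0] g(1)[OF y]]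
      mdist_triangle[OF f(1)[OF x0] g(1)[OF y0] g(1)[OF y]]
      f(2)[OF x x0] g(2)[OF y0 y] X[OF x x0] Y[OF y0 y]
    unfolding b_def by linarith
  have "0 < b"
    using bound[OF x0 y0] mdist_nonneg[of Z "f x0" "g y0"] by linarith
  then have "b \<in> ?R"
    using bound x0 y0 by blast
  then have "?R \<noteq> {}"
    by (rule ex_in_conv[THEN iffD1, OF exI])
  from cInf_lessD[OF this lt[unfolded hausdorff_dist_def]] obtain s where s: "s \<in> ?R" "s < r"
    by (elim bexE)
  then have "\<forall>y\<in>mspace Y. \<exists>x\<in>mspace X. mdist Z (f x) (g y) < s"
    by blast
  then obtain \<phi> where \<phi>: "\<And>y. y \<in> mspace Y \<Longrightarrow> \<phi> y \<in> mspace X \<and> mdist Z (f (\<phi> y)) (g y) < s"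
    by metis
  show thesis
  proof
    show "0 < s" "s < r" "\<phi> \<in> mspace Y \<rightarrow> mspace X"
      using s \<phi> by auto
    fix y y' assume y: "y \<in> mspace Y" and y': "y' \<in> mspace Y"
    have Z: "f (\<phi> y) \<in> mspace Z" "f (\<phi> y') \<in> mspace Z" "g y \<in> mspace Z" "g y' \<in> mspace Z"
      using f(1) g(1) \<phi> y y' by auto
    have "\<bar>mdist Z (f (\<phi> y)) (f (\<phi> y')) - mdist Z (g y) (g y')\<bar>
            \<le> mdist Z (f (\<phi> y)) (g y) + mdist Z (f (\<phi> y')) (g y')"
      using Z mdist_triangle[of "f (\<phi> y)" Z "g y" "f (\<phi> y')"]
        mdist_triangle[of "g y" Z "g y'" "f (\<phi> y')"]
        mdist_triangle[of "g y" Z "f (\<phi> y)" "g y'"]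
        mdist_triangle[of "f (\<phi> y)" Z "f (\<phi> y')" "g y'"]
        mdist_commute[of Z "f (\<phi> y)" "g y"] mdist_commute[of Z "f (\<phi> y')" "g y'"]
      by linarith
    then show "\<bar>mdist X (\<phi> y) (\<phi> y') - mdist Y y y'\<bar> \<le> 2 * s"
      using f(2)[of "\<phi> y" "\<phi> y'"] g(2)[OF y y'] \<phi>[OF y] \<phi>[OF y'] by simp
  qed
qed

lemma nsphere_finite_net:
  assumes "a < 1"
  obtains T where "finite T" "T \<subseteq> topspace (nsphere n)"
    "\<And>x. x \<in> topspace (nsphere n) \<Longrightarrow> \<exists>z\<in>T. a < (\<Sum>i\<le>n. x i * z i)"
proof -
  define U where "U z = {x :: nat \<Rightarrow> real. a < (\<Sum>i\<le>n. x i * z i)}" for z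
  have "open (U z)" for z
    unfolding U_def
    by (intro open_Collect_less continuous_on_const continuous_on_sum continuous_on_mult
          continuous_on_coordinate)
  moreover have "topspace (nsphere n) \<subseteq> (\<Union>z\<in>topspace (nsphere n). U z)"
  proof
    fix x assume x: "x \<in> topspace (nsphere n)"
    then have "x \<in> U x"
      using assms nsphere_inner_eq_1[OF x x] by (simp add: U_def)
    then show "x \<in> (\<Union>z\<in>topspace (nsphere n). U z)"
      using x by blast
  qed
  ultimately obtain T where "T \<subseteq> topspace (nsphere n)" "finite T" "topspace (nsphere n) \<subseteq> (\<Union>z\<in>T. U z)"
    by (rule compactE_image[OF compact_nsphere])
  then show thesis
    using that by (auto simp: U_def subset_iff)
qed

text \<open>
  The function \<open>\<theta>\<close> is the soft threshold: it is odd, 1-Lipschitz, and vanishes on \<open>[-a, a]\<close> for \<open>a = cos (\<epsilon> / 2)\<close>.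
  So \<open>G x\<close> is a combination of the values \<open>\<phi> z\<close> at the net points \<open>z\<close> within \<open>\<epsilon> / 2\<close> of \<open>x\<close>, with positive
  weights, and at those within \<open>\<epsilon> / 2\<close> of \<open>- x\<close>, with negative weights. If \<open>w\<close> is a net
  point close to \<open>x\<close>, every term has nonnegative inner product with \<open>\<phi> w\<close>, and the term of \<open>w\<close> itself
  has positive inner product. Hence \<open>G x\<close> is not zero, although \<open>G\<close> is odd and Lipschitz.
\<close>

lemma distortion_of_sphere_map_ge:
  fixes \<phi> :: "(nat \<Rightarrow> real) \<Rightarrow> nat \<Rightarrow> real"
  assumes "m < n" and \<phi>: "\<phi> \<in> topspace (nsphere n) \<rightarrow> topspace (nsphere m)"
      and dis: "\<And>y y'. \<lbrakk>y \<in> topspace (nsphere n); y' \<in> topspace (nsphere n)\<rbrakk> \<Longrightarrow>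
            \<bar>arccos (\<Sum>i\<le>m. \<phi> y i * \<phi> y' i) - arccos (\<Sum>i\<le>n. y i * y' i)\<bar> \<le> \<rho>"
  shows "pi / 2 \<le> \<rho>"
proof (rule ccontr)
  let ?S = "topspace (nsphere n)"
  define ip where "ip k x y = (\<Sum>i\<le>k. x i * y i)" for k and x y :: "nat \<Rightarrow> real"
  define \<epsilon> where "\<epsilon> = pi / 2 - \<rho>"
  assume "\<not> pi / 2 \<le> \<rho>"
  moreover have "0 \<le> \<rho>"
    using dis[OF in_topspace_nsphere in_topspace_nsphere] by linarith
  ultimately have \<epsilon>: "0 < \<epsilon>" "\<epsilon> \<le> pi / 2"
    by (simp_all add: \<epsilon>_def)
  define a where "a = cos (\<epsilon> / 2)"
  have arccos_a: "arccos a = \<epsilon> / 2"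
    using \<epsilon> by (simp add: a_def arccos_cos)
  have a: "0 < a" "a < 1"
    using \<epsilon> cos_monotone_0_pi[of 0 "\<epsilon> / 2"] by (auto simp: a_def intro!: cos_gt_zero)
  have ip_bounds: "- 1 \<le> ip k x y" "ip k x y \<le> 1"
    if "x \<in> topspace (nsphere k)" "y \<in> topspace (nsphere k)" for k x y
    using nsphere_inner_bounds[OF that] by (simp_all add: ip_def abs_le_iff)
  have ip_commute: "ip k x y = ip k y x" for k x y
    by (simp add: ip_def mult.commute)
  have near: "0 < ip m (\<phi> z) (\<phi> w)"
    if z: "z \<in> ?S" and w: "w \<in> ?S" and x: "x \<in> ?S" and xz: "a < ip n x z" and xw: "a < ip n x w" for x z w
  proof (rule ccontr)
    assume "\<not> ?thesis"
    then have "arccos 0 \<le> arccos (ip m (\<phi> z) (\<phi> w))"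
      using ip_bounds[of "\<phi> z" m "\<phi> w"] \<phi> z w by (intro arccos_le_arccos) auto
    moreover have "arccos (ip n x z) < arccos a" "arccos (ip n x w) < arccos a"
      using xz xw a ip_bounds[OF x z] ip_bounds[OF x w] by (auto intro!: arccos_less_arccos)
    moreover have "arccos (ip n z w) \<le> arccos (ip n x z) + arccos (ip n x w)"
      using nsphere_arccos_triangle[OF z x w] ip_commute[of n x z] by (simp add: ip_def)
    ultimately show False
      using dis[OF z w, folded ip_def] arccos_a \<epsilon>_def arccos_0 by linarith
  qed
  have far: "ip m (\<phi> z) (\<phi> w) < 0"
    if z: "z \<in> ?S" and w: "w \<in> ?S" and x: "x \<in> ?S" and xz: "ip n x z < - a" and xw: "a < ip n x w" for x z w
  proof (rule ccontr)
    assume "\<not> ?thesis"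
    then have "arccos (ip m (\<phi> z) (\<phi> w)) \<le> arccos 0"
      using ip_bounds[of "\<phi> z" m "\<phi> w"] \<phi> z w by (intro arccos_le_arccos) auto
    moreover have "arccos (- a) < arccos (ip n x z)" "arccos (ip n x w) < arccos a"
      using xz xw a ip_bounds[OF x z] ip_bounds[OF x w] by (auto intro!: arccos_less_arccos)
    moreover have "arccos (- a) = pi - arccos a"
      using a by (intro arccos_minus) auto
    moreover have "arccos (ip n x z) \<le> arccos (ip n x w) + arccos (ip n z w)"
      using nsphere_arccos_triangle[OF x w z] ip_commute[of n w z] by (simp add: ip_def)
    ultimately show False
      using dis[OF z w, folded ip_def] arccos_a \<epsilon>_def arccos_0 by linarith
  qed
  obtain T where T: "finite T" "T \<subseteq> ?S" "\<And>x. x \<in> ?S \<Longrightarrow> \<exists>z\<in>T. a < ip n x z"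
    using nsphere_finite_net[OF a(2), of n] unfolding ip_def by blast
  define \<theta> where "\<theta> t = max 0 (t - a) - max 0 (- t - a)" for t
  have \<theta>_sign: "a < t \<Longrightarrow> 0 < \<theta> t" "t < - a \<Longrightarrow> \<theta> t < 0" "\<bar>t\<bar> \<le> a \<Longrightarrow> \<theta> t = 0"
    and \<theta>_lip: "\<bar>\<theta> s - \<theta> t\<bar> \<le> \<bar>s - t\<bar>" and \<theta>_odd: "\<theta> (- t) = - \<theta> t" for s t
    using a by (auto simp: \<theta>_def max_def)
  define G where "G x i = (\<Sum>z\<in>T. \<theta> (ip n x z) * \<phi> z i)" for x i
  have Glip: "\<bar>G x i - G y i\<bar> \<le> real (card T) * (\<Sum>j\<le>n. \<bar>x j - y j\<bar>)" for x y i
  proof -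
    have "G x i - G y i = (\<Sum>z\<in>T. (\<theta> (ip n x z) - \<theta> (ip n y z)) * \<phi> z i)"
      by (simp add: G_def sum_subtractf left_diff_distrib)
    also have "\<bar>\<dots>\<bar> \<le> (\<Sum>z\<in>T. (\<Sum>j\<le>n. \<bar>x j - y j\<bar>))"
    proof (rule order_trans[OF sum_abs sum_mono])
      fix z assume "z \<in> T"
      then have z: "z \<in> ?S" and \<phi>z: "\<phi> z \<in> topspace (nsphere m)"
        using T(2) \<phi> by auto
      have "\<bar>\<theta> (ip n x z) - \<theta> (ip n y z)\<bar> \<le> \<bar>ip n x z - ip n y z\<bar>"
        by (rule \<theta>_lip)
      also have "\<dots> = \<bar>\<Sum>j\<le>n. (x j - y j) * z j\<bar>"
        by (simp add: ip_def sum_subtractf left_diff_distrib)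
      also have "\<dots> \<le> (\<Sum>j\<le>n. \<bar>x j - y j\<bar>)"
        by (rule order_trans[OF sum_abs sum_mono])
           (simp add: abs_mult mult_left_le nsphere_coordinate_le_1[OF z])
      finally have "\<bar>\<theta> (ip n x z) - \<theta> (ip n y z)\<bar> \<le> (\<Sum>j\<le>n. \<bar>x j - y j\<bar>)" .
      then have "\<bar>\<theta> (ip n x z) - \<theta> (ip n y z)\<bar> * \<bar>\<phi> z i\<bar> \<le> (\<Sum>j\<le>n. \<bar>x j - y j\<bar>) * 1"
        by (intro mult_mono nsphere_coordinate_le_1[OF \<phi>z]) (auto simp: sum_nonneg)
      then show "\<bar>(\<theta> (ip n x z) - \<theta> (ip n y z)) * \<phi> z i\<bar> \<le> (\<Sum>j\<le>n. \<bar>x j - y j\<bar>)"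
        by (simp add: abs_mult)
    qed
    finally show ?thesis by simp
  qed
  have Godd: "G (\<lambda>j. - x j) i = - G x i" for x i
  proof -
    have "ip n (\<lambda>j. - x j) z = - ip n x z" for z
      by (simp add: ip_def sum_negf)
    then show ?thesis
      by (simp add: G_def \<theta>_odd sum_negf)
  qed
  obtain x where x: "x \<in> ?S" and Gx: "\<And>i. i \<le> m \<Longrightarrow> G x i = 0"
    by (rule no_odd_lipschitz_map_to_lower_dimension[OF \<open>m < n\<close> Glip Godd]) (rule that)
  obtain w where w: "w \<in> T" "a < ip n x w"
    using T(3)[OF x] by blast
  have "0 < (\<Sum>z\<in>T. \<theta> (ip n x z) * ip m (\<phi> z) (\<phi> w))"
  proof (rule sum_pos2[OF T(1) w(1)])
    show "0 < \<theta> (ip n x w) * ip m (\<phi> w) (\<phi> w)"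
      using near[of w w x] w T(2) x by (intro mult_pos_pos \<theta>_sign(1)) auto
    fix z assume "z \<in> T"
    then have z: "z \<in> ?S" and w': "w \<in> ?S"
      using T(2) w(1) by auto
    consider "a < ip n x z" | "ip n x z < - a" | "\<bar>ip n x z\<bar> \<le> a" by linarith
    then show "0 \<le> \<theta> (ip n x z) * ip m (\<phi> z) (\<phi> w)"
    proof cases
      case 1
      then show ?thesis
        using near[OF z w' x 1 w(2)] \<theta>_sign(1)[OF 1] by simp
    next
      case 2
      then show ?thesis
        using far[OF z w' x 2 w(2)] \<theta>_sign(2)[OF 2] by (simp add: mult_nonpos_nonpos)
    qed (simp add: \<theta>_sign(3))
  qed
  also have "\<dots> = (\<Sum>i\<le>m. G x i * \<phi> w i)"
    unfolding G_def ip_def sum_distrib_left sum_distrib_right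
    by (subst sum.swap) (simp add: mult.assoc)
  also have "\<dots> = 0"
    using Gx by simp
  finally show False by simp
qed

theorem corollary1p12:
  fixes m n :: nat
  assumes "0 < m" and "m < n"
  shows "gh_dist (geodesic_sphere m) (geodesic_sphere n) \<ge> pi / 4"
proof (rule ccontr)
  have ms: "mspace (geodesic_sphere k) = topspace (nsphere k)" for k
    by (simp add: mspace_geodesic_sphere topspace_nsphere_eq)
  have diam: "mdist (geodesic_sphere k) x y \<le> pi"
    if "x \<in> mspace (geodesic_sphere k)" "y \<in> mspace (geodesic_sphere k)" for k x y
    using nsphere_inner_bounds[of x k y] that
    by (simp add: mdist_geodesic_sphere ms abs_le_iff arccos_ubound)
  have ne: "mspace (geodesic_sphere k) \<noteq> {}" for k
    using in_topspace_nsphere[of k] by (auto simp: ms)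
  assume "\<not> ?thesis"
  then have "gh_dist (geodesic_sphere m) (geodesic_sphere n) < pi / 4"
    by simp
  then show False
  proof (rule gh_dist_less_imp_almost_isometry[where B = pi])
    fix s \<phi>
    assume s: "s < pi / 4" and \<phi>: "\<phi> \<in> mspace (geodesic_sphere n) \<rightarrow> mspace (geodesic_sphere m)"
      and dis: "\<And>y y'. \<lbrakk>y \<in> mspace (geodesic_sphere n); y' \<in> mspace (geodesic_sphere n)\<rbrakk> \<Longrightarrow>
         \<bar>mdist (geodesic_sphere m) (\<phi> y) (\<phi> y') - mdist (geodesic_sphere n) y y'\<bar> \<le> 2 * s"
    have "pi / 2 \<le> 2 * s"
    proof (rule distortion_of_sphere_map_ge[OF \<open>m < n\<close>])
      show "\<phi> \<in> topspace (nsphere n) \<rightarrow> topspace (nsphere m)"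
        using \<phi> by (simp add: ms)
      fix y y' assume y: "y \<in> topspace (nsphere n)" "y' \<in> topspace (nsphere n)"
      then have "\<phi> y \<in> topspace (nsphere m)" "\<phi> y' \<in> topspace (nsphere m)"
        using \<phi> by (auto simp: ms)
      then show "\<bar>arccos (\<Sum>i\<le>m. \<phi> y i * \<phi> y' i) - arccos (\<Sum>i\<le>n. y i * y' i)\<bar> \<le> 2 * s"
        using dis[of y y'] y by (simp add: mdist_geodesic_sphere ms)
    qed
    with s show False
      by simp
  qed (use diam ne in auto)
qed

end
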